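(* Let $k$ be a field, $R=k[x,y,z]$ and $\mathfrak m=(x,y,z)$. Suppose that $I,J,K$ are $\mathfrak m$-primary monomial ideals of $R$ such that $I^rJ^sK^t$ is complete for all integers $r,s,t\ge0$ with $r+s+t\le2$. Then $I^rJ^sK^t$ is complete for all integers $r,s,t\ge0$.
   Context: An ideal is complete if it is integrally closed, i.e. equal to its integral closure. The zeroth power of an ideal is $R$. *)

theory Defs
  imports
    Complex_Main
    "HOL-Library.Poly_Mapping"
    "HOL-Library.Numeral_Type"
begin

text \<open>
  Ideals of a commutative ring are the submodules of the ring regarded as a module over itself,
  so the library's \<open>module.subspace\<close> and \<open>module.span\<close> are used for ideals and generated ideals.
  The locale is not interpreted globally because some of its simplification rules
  (such as \<open>a * (b * x) = a * b * x\<close>) interfere with the standard ones for rings.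
\<close>

lemma module_times: "module ((*) :: 'a::comm_ring_1 \<Rightarrow> 'a \<Rightarrow> 'a)"
  by unfold_locales (simp_all add: algebra_simps)

definition is_ideal :: "'a::comm_ring_1 set \<Rightarrow> bool" where
  "is_ideal I \<longleftrightarrow> module.subspace (*) I"

definition ideal_gen :: "'a::comm_ring_1 set \<Rightarrow> 'a set" where
  "ideal_gen S = module.span (*) S"

lemma is_ideal_iff:
  "is_ideal I \<longleftrightarrow> 0 \<in> I \<and> (\<forall>a\<in>I. \<forall>b\<in>I. a + b \<in> I) \<and> (\<forall>c. \<forall>a\<in>I. c * a \<in> I)"
  by (simp add: is_ideal_def module.subspace_def[OF module_times])

lemma is_ideal_ideal_gen: "is_ideal (ideal_gen S)"
  by (simp add: is_ideal_def ideal_gen_def module.subspace_span[OF module_times])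

definition ideal_mult :: "'a::comm_ring_1 set \<Rightarrow> 'a set \<Rightarrow> 'a set" where
  "ideal_mult I J = ideal_gen {a * b | a b. a \<in> I \<and> b \<in> J}"

primrec ideal_power :: "'a::comm_ring_1 set \<Rightarrow> nat \<Rightarrow> 'a set" where
  "ideal_power I 0 = UNIV"
| "ideal_power I (Suc n) = ideal_mult I (ideal_power I n)"

definition radical :: "'a::comm_ring_1 set \<Rightarrow> 'a set" where
  "radical I = {f. \<exists>n>0. f ^ n \<in> I}"

definition primary_ideal :: "'a::comm_ring_1 set \<Rightarrow> bool" where
  "primary_ideal Q \<longleftrightarrow> is_ideal Q \<and> Q \<noteq> UNIV \<and>
     (\<forall>a b. a * b \<in> Q \<longrightarrow> a \<in> Q \<or> (\<exists>n>0. b ^ n \<in> Q))"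

definition primary_to :: "'a::comm_ring_1 set \<Rightarrow> 'a set \<Rightarrow> bool" where
  "primary_to P Q \<longleftrightarrow> primary_ideal Q \<and> radical Q = P"

text \<open>\<open>f\<close> is integral over \<open>I\<close> if it satisfies an equation
  \<open>f ^ n + a 1 * f ^ (n - 1) + \<dots> + a n = 0\<close> with \<open>n \<ge> 1\<close> and \<open>a i\<close> in the \<open>i\<close>-th power of \<open>I\<close>.\<close>

definition integral_over_ideal :: "'a::comm_ring_1 set \<Rightarrow> 'a \<Rightarrow> bool" where
  "integral_over_ideal I f \<longleftrightarrow>
     (\<exists>n>0. \<exists>a. (\<forall>i\<in>{1..n}. a i \<in> ideal_power I i) \<and>
        f ^ n + (\<Sum>i=1..n. a i * f ^ (n - i)) = 0)"

definition integral_closure :: "'a::comm_ring_1 set \<Rightarrow> 'a set" where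
  "integral_closure I = {f. integral_over_ideal I f}"

definition complete_ideal :: "'a::comm_ring_1 set \<Rightarrow> bool" where
  "complete_ideal I \<longleftrightarrow> is_ideal I \<and> integral_closure I = I"

text \<open>
  The polynomial ring in three variables over \<open>'k\<close>, as the monoid algebra of the exponent
  vectors: the type \<open>3\<close> has the elements \<open>0, 1, 2\<close>, which index the variables \<open>x, y, z\<close>.
\<close>

type_synonym 'k poly3 = "(3 \<Rightarrow>\<^sub>0 nat) \<Rightarrow>\<^sub>0 'k"

definition monomial :: "(3 \<Rightarrow>\<^sub>0 nat) \<Rightarrow> 'k::field poly3" where
  "monomial e = Poly_Mapping.single e 1"

definition Var :: "3 \<Rightarrow> 'k::field poly3" where
  "Var i = monomial (Poly_Mapping.single i 1)"

definition max_ideal_xyz :: "'k::field poly3 set" where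
  "max_ideal_xyz = ideal_gen {Var 0, Var 1, Var 2}"

definition monomial_ideal :: "'k::field poly3 set \<Rightarrow> bool" where
  "monomial_ideal I \<longleftrightarrow> (\<exists>E. I = ideal_gen (monomial ` E))"

end

(*
  By a Caratheodory argument, an exponent in the Newton polyhedron of I^r J^s K^t with
  r + s + t >= 3 dominates a sum of generators with nonnegative weights of total r, s, t for I, J, K
  in which some weight is at least 1. Splitting off this generator leaves an exponent in the Newton
  polyhedron of a product of total degree one less, so by induction everything reduces to the
  products of total degree at most 2.
  That the exponents of integral elements lie in the Newton polyhedron is proved over the natural
  numbers: an exponent outside would give an extreme point of the polyhedron enlarged by it, and
  the corresponding power could not cancel in the equation of integral dependence.
*)
theory Submission
  imports Defs "HOL-Library.Multiset"
begin

section \<open>Integral equations and exponents\<close>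

text \<open>The bound 2 is the number of variables minus one. If all weights were below 1, an ideal
  of degree d > 0 would need at least d + 1 generators, so the generators would outnumber the ideals
  involved by at least r + s + t; from 3 on this suffices for a linear relation that can be used to
  drop a generator. Convexity is expressed by multiples: a point a of a polyhedron is recorded
  through some N > 0 such that N a is an exponent of the N-th power. This matches the integral
  equation T^N - x^(N a) of the monomial x^a, and it turns weights into multiplicities in a multiset
  of generators, which is finite even if the generating sets are not. The generator that splits off
  may belong to any of the ideals, so the induction runs over all exponent tuples at once, written
  as a function d.\<close>

abbreviation "lookup \<equiv> Poly_Mapping.lookup"
abbreviation "keys \<equiv> Poly_Mapping.keys"

definition scale :: "nat \<Rightarrow> ('v \<Rightarrow>\<^sub>0 nat) \<Rightarrow> ('v \<Rightarrow>\<^sub>0 nat)" where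
  "scale n a = (\<Sum>i<n. a)"

text \<open>Models the exponent sets of the powers of a monomial ideal, \<open>V k\<close> belonging
  to the \<open>k\<close>-th power. \<open>V 0 = UNIV\<close> reflects the zeroth power and also
  makes every \<open>V k\<close> closed under adding arbitrary exponents.\<close>

definition superadditive :: "(nat \<Rightarrow> ('v \<Rightarrow>\<^sub>0 nat) set) \<Rightarrow> bool" where
  "superadditive V \<longleftrightarrow> V 0 = UNIV \<and> (\<forall>k l. \<forall>x\<in>V k. \<forall>y\<in>V l. x + y \<in> V (k + l))"

text \<open>If \<open>V\<close> comes from the powers of a monomial ideal and \<open>n > 0\<close>,
  these are the lattice points of \<open>n\<close> times its Newton polyhedron; \<open>N\<close>
  clears the denominators of the weights.\<close>

definition saturation :: "(nat \<Rightarrow> ('v \<Rightarrow>\<^sub>0 nat) set) \<Rightarrow> nat \<Rightarrow> ('v \<Rightarrow>\<^sub>0 nat) set" where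
  "saturation V n = {a. \<exists>N>0. scale N a \<in> V (N * n)}"

text \<open>The exponents of the powers of the ideal enlarged by the monomial with exponent
  \<open>a\<close>: \<open>j\<close> factors are the new monomial and \<open>l\<close> come from the
  old ideal.\<close>

definition adjoin :: "('v \<Rightarrow>\<^sub>0 nat) \<Rightarrow> (nat \<Rightarrow> ('v \<Rightarrow>\<^sub>0 nat) set) \<Rightarrow> nat \<Rightarrow> ('v \<Rightarrow>\<^sub>0 nat) set" where
  "adjoin a V k = {scale j a + v | j l v. j + l = k \<and> v \<in> V l}"

lemma lookup_scale [simp]: "lookup (scale n a) v = n * lookup a v"
  by (simp add: scale_def lookup_sum)

lemma scale_0 [simp]: "scale 0 a = 0" and scale_1 [simp]: "scale (Suc 0) a = a"
  and scale_Suc: "scale (Suc n) a = a + scale n a"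
  and scale_add_left: "scale (m + n) a = scale m a + scale n a"
  and scale_add_right: "scale n (a + b) = scale n a + scale n b"
  and scale_scale: "scale m (scale n a) = scale (m * n) a"
  by (auto intro!: poly_mapping_eqI simp: lookup_add algebra_simps)

lemma scale_cancel: "n > 0 \<Longrightarrow> scale n a = scale n b \<Longrightarrow> a = b"
  by (metis lookup_scale mult_cancel1 not_gr_zero poly_mapping_eqI)

text \<open>At most one pair of terms contributes at \<open>x + y\<close>, since
  \<open>b = x\<close> gives \<open>c = y\<close> by cancellation. If \<open>x\<close> or
  \<open>y\<close> is not an exponent, both sides are zero.\<close>

lemma lookup_mult_unique:
  fixes f g :: "'a::cancel_comm_monoid_add \<Rightarrow>\<^sub>0 'b::comm_ring_1"
  assumes uniq: "\<And>b c. b \<in> keys f \<Longrightarrow> c \<in> keys g \<Longrightarrow> b + c = x + y \<Longrightarrow> b = x"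
  shows "lookup (f * g) (x + y) = lookup f x * lookup g y"
proof -
  define f0 where "f0 = f - Poly_Mapping.single x (lookup f x)"
  define g0 where "g0 = g - Poly_Mapping.single y (lookup g y)"
  have f0: "keys f0 \<subseteq> keys f - {x}"
    by (auto simp: f0_def in_keys_iff lookup_minus lookup_single when_def split: if_splits)
  have g0: "keys g0 \<subseteq> keys g - {y}"
    by (auto simp: g0_def in_keys_iff lookup_minus lookup_single when_def split: if_splits)
  \<comment> \<open>One term of each factor is peeled off: \<open>uniq\<close> keeps
    \<open>x + y\<close> out of the first summand, cancellation keeps it out of the second.\<close>
  have "f * g = f0 * g + Poly_Mapping.single x (lookup f x) * g0
      + Poly_Mapping.single x (lookup f x) * Poly_Mapping.single y (lookup g y)"
    by (simp add: f0_def g0_def algebra_simps)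
  moreover have "lookup (f0 * g) (x + y) = 0"
  proof (rule ccontr)
    assume "lookup (f0 * g) (x + y) \<noteq> 0"
    then have "x + y \<in> {b + c | b c. b \<in> keys f0 \<and> c \<in> keys g}"
      using keys_mult[of f0 g] by (simp add: in_keys_iff subset_iff)
    then obtain b c where "b \<in> keys f0" "c \<in> keys g" "x + y = b + c" by blast
    then show False using f0 uniq[of b c] by auto
  qed
  moreover have "lookup (Poly_Mapping.single x (lookup f x) * g0) (x + y) = 0" (is "lookup ?h _ = 0")
  proof (rule ccontr)
    assume "lookup ?h (x + y) \<noteq> 0"
    then have "x + y \<in> {b + c | b c. b \<in> keys (Poly_Mapping.single x (lookup f x)) \<and> c \<in> keys g0}"
      using keys_mult[of "Poly_Mapping.single x (lookup f x)" g0] by (simp add: in_keys_iff subset_iff)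
    then obtain b c where *: "b \<in> keys (Poly_Mapping.single x (lookup f x))" "c \<in> keys g0"
      "x + y = b + c" by blast
    then have "b = x" by (simp split: if_splits)
    with * show False using g0 by auto
  qed
  ultimately show ?thesis
    by (simp add: lookup_add mult_single)
qed

section \<open>Superadditive families, saturation, and adjoining a point\<close>

lemma superadditiveD: "superadditive V \<Longrightarrow> x \<in> V k \<Longrightarrow> y \<in> V l \<Longrightarrow> x + y \<in> V (k + l)"
  by (simp add: superadditive_def)

lemma superadditive_scale:
  assumes "superadditive V" "x \<in> V k"
  shows "scale n x \<in> V (n * k)"
proof (induction n)
  case 0
  then show ?case using assms by (simp add: superadditive_def)
next
  case (Suc n)
  then show ?case using superadditiveD[OF assms(1,2) Suc] by (simp add: scale_Suc)
qed

lemma subset_adjoin: "V k \<subseteq> adjoin a V k"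
proof
  fix v assume "v \<in> V k"
  moreover have "v = scale 0 a + v" "0 + k = k" by simp_all
  ultimately show "v \<in> adjoin a V k" unfolding adjoin_def by blast
qed

lemma adjoin_self:
  assumes "superadditive V"
  shows "a \<in> adjoin a V 1"
proof -
  have "0 \<in> V 0" using assms unfolding superadditive_def by blast
  then show ?thesis
    unfolding adjoin_def by (intro CollectI exI[of _ 1] exI[of _ "0::nat"] exI[of _ 0]) simp
qed

lemma superadditive_adjoin:
  assumes V: "superadditive V"
  shows "superadditive (adjoin a V)"
  unfolding superadditive_def
proof (intro conjI allI ballI)
  show "adjoin a V 0 = UNIV"
    using V subset_adjoin[of V 0 a] by (auto simp: superadditive_def)
  fix k l x y assume "x \<in> adjoin a V k" "y \<in> adjoin a V l"
  then obtain i i' v j j' w where *: "x = scale i a + v" "v \<in> V i'" "i + i' = k"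
    "y = scale j a + w" "w \<in> V j'" "j + j' = l"
    by (auto simp: adjoin_def)
  have "x + y = scale (i + j) a + (v + w)" "v + w \<in> V (i' + j')" "i + j + (i' + j') = k + l"
    using * superadditiveD[OF V] by (auto simp: scale_add_left algebra_simps)
  then show "x + y \<in> adjoin a V (k + l)"
    unfolding adjoin_def by blast
qed

lemma saturationI: "N > 0 \<Longrightarrow> scale N a \<in> V (N * n) \<Longrightarrow> a \<in> saturation V n"
  by (auto simp: saturation_def)

lemma saturation_superset: "V n \<subseteq> saturation V n"
  unfolding saturation_def by (auto intro!: exI[of _ "Suc 0"])

lemma superadditive_saturation:
  assumes V: "superadditive V"
  shows "superadditive (saturation V)"
  unfolding superadditive_def
proof (intro conjI allI ballI)
  show "saturation V 0 = UNIV"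
    using V by (auto simp: superadditive_def saturation_def)
  fix k l x y assume "x \<in> saturation V k" "y \<in> saturation V l"
  then obtain M N where *: "M > 0" "scale M x \<in> V (M * k)" "N > 0" "scale N y \<in> V (N * l)"
    by (auto simp: saturation_def)
  \<comment> \<open>The multipliers \<open>M\<close> and \<open>N\<close> are replaced by the common
    multiplier \<open>M * N\<close>.\<close>
  have "scale N (scale M x) + scale M (scale N y) \<in> V (N * (M * k) + M * (N * l))"
    by (intro superadditiveD[OF V] superadditive_scale[OF V] *)
  moreover have "scale N (scale M x) + scale M (scale N y) = scale (M * N) (x + y)"
    by (simp add: scale_scale scale_add_right mult.commute)
  ultimately have "scale (M * N) (x + y) \<in> V (M * N * (k + l))"
    by (simp add: algebra_simps)
  then show "x + y \<in> saturation V (k + l)"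
    using * unfolding saturation_def by (auto intro!: exI[of _ "M * N"])
qed

text \<open>A point that already lies in the polyhedron adds nothing to it: after multiplication by
  \<open>M\<close>, each of the \<open>j\<close> copies of \<open>a\<close> becomes an element of
  \<open>V M\<close>.\<close>

lemma saturation_adjoin_subset:
  assumes V: "superadditive V" and a: "a \<in> saturation V 1"
  shows "saturation (adjoin a V) n \<subseteq> saturation V n"
proof
  fix b assume "b \<in> saturation (adjoin a V) n"
  then obtain N j l v where b: "N > 0" "scale N b = scale j a + v" "j + l = N * n" "v \<in> V l"
    by (auto simp: saturation_def adjoin_def)
  obtain M where M: "M > 0" "scale M a \<in> V M"
    using a by (auto simp: saturation_def)
  have "scale (M * N) b = scale j (scale M a) + scale M v"
    using arg_cong[OF b(2), of "scale M"] by (simp add: scale_scale scale_add_right mult.commute)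
  also have "\<dots> \<in> V (j * M + M * l)"
    by (intro superadditiveD[OF V] superadditive_scale[OF V] M b)
  also have "j * M + M * l = M * N * n"
    using b(3) by (metis distrib_left mult.assoc mult.commute)
  finally show "b \<in> saturation V n"
    using b M by (auto simp: saturation_def intro!: exI[of _ "M * N"])
qed

text \<open>If \<open>a\<close> is outside the saturation, it is an extreme point of the saturation after it has been
  adjoined.\<close>

lemma extreme_adjoin:
  assumes V: "superadditive V" and a: "a \<notin> saturation V 1"
    and b: "b \<in> saturation (adjoin a V) n" and c: "c \<in> saturation (adjoin a V) m"
    and eq: "b + c = scale n a + scale m a"
  shows "b = scale n a"
proof -
  from b obtain N j l v where b: "N > 0" "scale N b = scale j a + v" "j + l = N * n" "v \<in> V l"
    by (auto simp: saturation_def adjoin_def)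
  from c obtain M i k w where c: "M > 0" "scale M c = scale i a + w" "i + k = M * m" "w \<in> V k"
    by (auto simp: saturation_def adjoin_def)
  have "scale (M * N) (b + c) = scale M (scale N b) + scale N (scale M c)"
    by (simp add: scale_scale scale_add_right mult.commute)
  also have "\<dots> = scale (M * j + N * i) a + (scale M v + scale N w)"
    unfolding b c by (simp add: scale_scale scale_add_right scale_add_left algebra_simps)
  finally have *: "scale (M * N) (b + c) = scale (M * j + N * i) a + (scale M v + scale N w)" .
  \<comment> \<open>By the degree counts in \<open>b\<close> and \<open>c\<close>, the same multiple
    consists of copies of \<open>a\<close> only. Cancelling those common to both expressions
    compares the rest with \<open>v\<close> and \<open>w\<close>.\<close>
  have "scale (M * N) (b + c) = scale (M * j + N * i) a + scale (M * l + N * k) a"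
  proof -
    have "M * N * (n + m) = M * (N * n) + N * (M * m)" by (simp add: algebra_simps)
    also have "\<dots> = (M * j + N * i) + (M * l + N * k)"
      by (simp add: b(3)[symmetric] c(3)[symmetric] algebra_simps)
    finally show ?thesis
      unfolding eq scale_add_left[symmetric] scale_scale by simp
  qed
  with * have "scale (M * l + N * k) a = scale M v + scale N w" by simp
  moreover have "scale M v + scale N w \<in> V (M * l + N * k)"
    using b c V by (intro superadditiveD superadditive_scale) auto
  ultimately have "scale (M * l + N * k) a \<in> V (M * l + N * k)" by simp
  \<comment> \<open>A positive degree would itself be a multiplier that puts \<open>a\<close> into
    the saturation.\<close>
  then have "\<not> M * l + N * k > 0"
    using a saturationI[of "M * l + N * k" a V 1] by (metis mult_1_right)
  then have 0: "l = 0" "k = 0" using b c by auto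
  with \<open>scale (M * l + N * k) a = _\<close> have "scale M v + scale N w = 0" by simp
  \<comment> \<open>Membership in \<open>V 0\<close> says nothing about \<open>v\<close>; it
    vanishes because a sum of naturals is zero and \<open>M\<close> is positive.\<close>
  then have "v = 0"
    using c(1) by (intro poly_mapping_eqI) (auto dest!: arg_cong[of _ 0 lookup] simp: lookup_add fun_eq_iff)
  then have "scale N b = scale N (scale n a)"
    using b 0 by (simp add: scale_scale)
  then show ?thesis using scale_cancel b by blast
qed

text \<open>If \<open>a\<close> is outside the saturation, extremality isolates the coefficient at
  \<open>scale n a\<close>: the power \<open>f ^ n\<close> contributes
  \<open>lookup f a ^ n\<close>, which is nonzero, and the other terms of the equation contribute
  nothing. So this case is contradictory.\<close>

lemma saturation_adjoin_remove:
  fixes f :: "('v \<Rightarrow>\<^sub>0 nat) \<Rightarrow>\<^sub>0 'k::field"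
  assumes V: "superadditive V" and n: "n > 0" and c: "\<forall>i\<in>{1..n}. keys (c i) \<subseteq> V i"
    and eq: "f ^ n + (\<Sum>i=1..n. c i * f ^ (n - i)) = 0"
    and f: "keys f \<subseteq> saturation (adjoin a V) 1" and a: "a \<in> keys f"
  shows "keys f \<subseteq> saturation V 1"
proof (cases "a \<in> saturation V 1")
  case True
  then show ?thesis using f saturation_adjoin_subset[OF V] by blast
next
  case False
  let ?W = "saturation (adjoin a V)"
  have W: "superadditive ?W"
    by (intro superadditive_saturation superadditive_adjoin V)
  \<comment> \<open>The support is carried along because \<open>extreme_adjoin\<close> requires the
    exponents of \<open>f ^ k\<close> to lie in the saturation of degree \<open>k\<close>.\<close>
  have pow: "keys (f ^ k) \<subseteq> ?W k \<and> lookup (f ^ k) (scale k a) = lookup f a ^ k" for k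
  proof (induction k)
    case 0
    then show ?case using W by (simp add: superadditive_def lookup_one)
  next
    case (Suc k)
    have "b + c \<in> ?W (Suc k)" if "b \<in> keys f" "c \<in> keys (f ^ k)" for b c
      using superadditiveD[OF W, of b 1 c k] that Suc f by auto
    then have "keys (f * f ^ k) \<subseteq> ?W (Suc k)"
      using keys_mult[of f "f ^ k"] by blast
    moreover have "lookup (f * f ^ k) (a + scale k a) = lookup f a * lookup (f ^ k) (scale k a)"
    proof (rule lookup_mult_unique)
      fix b c assume *: "b \<in> keys f" "c \<in> keys (f ^ k)" "b + c = a + scale k a"
      show "b = a"
        using extreme_adjoin[OF V False, of b 1 c k] * f Suc by auto
    qed
    ultimately show ?case using Suc by (simp add: scale_Suc)
  qed
  have zero: "lookup (c i * f ^ (n - i)) (scale n a) = 0" if i: "i \<in> {1..n}" for i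
  proof -
    have "V i \<subseteq> ?W i"
      using subset_adjoin[of V i a] saturation_superset[of "adjoin a V" i] by blast
    then have "lookup (c i * f ^ (n - i)) (scale i a + scale (n - i) a)
        = lookup (c i) (scale i a) * lookup (f ^ (n - i)) (scale (n - i) a)"
      using pow[of "n - i"] bspec[OF c i]
      by (intro lookup_mult_unique extreme_adjoin[OF V False]) blast+
    \<comment> \<open>Otherwise the positive number \<open>i\<close> would be a multiplier showing
      \<open>a \<in> saturation V 1\<close>.\<close>
    moreover have "scale i a \<notin> V i"
      using False i saturationI[of i a V 1] by auto
    then have "lookup (c i) (scale i a) = 0"
      using c i by (auto simp: in_keys_iff subset_iff)
    moreover have "scale i a + scale (n - i) a = scale n a"
      using i by (simp flip: scale_add_left)
    ultimately show ?thesis by simp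
  qed
  have "lookup (f ^ n + (\<Sum>i=1..n. c i * f ^ (n - i))) (scale n a) = lookup f a ^ n"
    using pow zero by (simp add: lookup_add lookup_sum)
  then show ?thesis using eq a n by (simp add: in_keys_iff)
qed

text \<open>Once all exponents of \<open>f\<close> are adjoined, the inclusion is trivial; they are
  then removed one at a time. The exponent being removed is redundant or extreme over the remaining
  ones, so no vertex has to be searched for. The equation stays applicable because its coefficients
  already lie in \<open>U\<close>.\<close>

lemma keys_integral_subset_saturation:
  fixes f :: "('v \<Rightarrow>\<^sub>0 nat) \<Rightarrow>\<^sub>0 'k::field"
  assumes U: "superadditive U" and n: "n > 0" and c: "\<forall>i\<in>{1..n}. keys (c i) \<subseteq> U i"
    and eq: "f ^ n + (\<Sum>i=1..n. c i * f ^ (n - i)) = 0"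
  shows "keys f \<subseteq> saturation U 1"
proof -
  define V where "V xs = foldr adjoin xs U" for xs
  have V: "superadditive (V xs)" for xs
    by (induction xs) (simp_all add: V_def U superadditive_adjoin)
  have UV: "U k \<subseteq> V xs k" for xs k
  proof (induction xs)
    case (Cons a xs)
    then show ?case using subset_adjoin[of "V xs" k a] by (simp add: V_def)
  qed (simp add: V_def)
  have remove: "set xs \<subseteq> keys f \<Longrightarrow> keys f \<subseteq> saturation (V xs) 1 \<Longrightarrow> keys f \<subseteq> saturation U 1" for xs
  proof (induction xs)
    case Nil
    then show ?case by (simp add: V_def)
  next
    case (Cons a xs)
    have "keys f \<subseteq> saturation (V xs) 1"
    proof (rule saturation_adjoin_remove[OF V n _ eq])
      show "\<forall>i\<in>{1..n}. keys (c i) \<subseteq> V xs i" using c UV[of _ xs] by (meson subset_trans)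
      show "keys f \<subseteq> saturation (adjoin a (V xs)) 1"
        using Cons.prems(2) by (simp add: V_def)
      show "a \<in> keys f"
        using Cons.prems(1) by simp
    qed
    then show ?case using Cons by simp
  qed
  have mem: "set xs \<subseteq> V xs 1" for xs
  proof (induction xs)
    case (Cons a xs)
    show ?case using Cons subset_adjoin[of "V xs" 1 a] adjoin_self[OF V[of xs], of a] by (auto simp: V_def)
  qed simp
  obtain xs where "set xs = keys f" using finite_list[OF finite_keys] ..
  then show ?thesis using remove[of xs] mem[of xs] saturation_superset[of "V xs" 1] by auto
qed

section \<open>A Caratheodory argument with integer weights\<close>

text \<open>Gaussian elimination with \<open>F\<close> indexing the unknowns and \<open>B\<close>
  the equations. Cross-multiplication replaces division, so that the solution stays in the ring,
  which will be the integers.\<close>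

lemma homogeneous_system_nontrivial:
  fixes c :: "'b \<Rightarrow> 'p \<Rightarrow> 'r::idom"
  assumes "finite B" "finite F" "card B < card F"
  shows "\<exists>\<mu>. (\<exists>p\<in>F. \<mu> p \<noteq> 0) \<and> (\<forall>b\<in>B. (\<Sum>p\<in>F. \<mu> p * c b p) = 0)"
  using assms
proof (induction B arbitrary: F c rule: finite_induct)
  case empty
  then obtain p where "p \<in> F" by fastforce
  then show ?case by (intro exI[of _ "\<lambda>_. 1"]) auto
next
  case (insert b B)
  show ?case
  proof (cases "\<forall>p\<in>F. c b p = 0")
    case True
    have "card B < card F" using insert by simp
    with insert.IH[of F c] insert.prems
    obtain \<mu> where "\<exists>p\<in>F. \<mu> p \<noteq> 0" "\<forall>b\<in>B. (\<Sum>p\<in>F. \<mu> p * c b p) = 0"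
      by blast
    with True show ?thesis by (intro exI[of _ \<mu>]) auto
  next
    case False
    then obtain q where q: "q \<in> F" "c b q \<noteq> 0" by blast
    define F' where "F' = F - {q}"
    have F: "F = insert q F'" "q \<notin> F'" "finite F'" using q insert.prems by (auto simp: F'_def)
    have "card B < card F'" using insert F by simp
    \<comment> \<open>Equation \<open>b\<close> eliminates the unknown \<open>q\<close>; the new
      coefficients are the 2x2 minors with pivot \<open>c b q\<close>.\<close>
    from insert.IH[OF F(3) this, of "\<lambda>b' p. c b q * c b' p - c b' q * c b p"]
    obtain \<nu> where \<nu>: "\<exists>p\<in>F'. \<nu> p \<noteq> 0"
      "\<forall>b'\<in>B. (\<Sum>p\<in>F'. \<nu> p * (c b q * c b' p - c b' q * c b p)) = 0" by blast
    define S where "S b' = (\<Sum>p\<in>F'. \<nu> p * c b' p)" for b'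
    \<comment> \<open>Back substitution: the other values are scaled by the pivot, so that the value
      at \<open>q\<close> solves equation \<open>b\<close> without a division.\<close>
    define \<mu> where "\<mu> p = (if p = q then - S b else c b q * \<nu> p)" for p
    have sum: "(\<Sum>p\<in>F. \<mu> p * c b' p) = c b q * S b' - c b' q * S b" for b'
    proof -
      have "(\<Sum>p\<in>F'. \<mu> p * c b' p) = (\<Sum>p\<in>F'. c b q * (\<nu> p * c b' p))"
        using F by (intro sum.cong) (auto simp: \<mu>_def)
      also have "\<dots> = c b q * S b'" by (simp add: S_def sum_distrib_left)
      finally show ?thesis
        unfolding F(1) sum.insert[OF F(3,2)] by (simp add: \<mu>_def)
    qed
    have "c b q * S b' - c b' q * S b = 0" if "b' \<in> B" for b'
    proof -
      have "c b q * S b' - c b' q * S b = (\<Sum>p\<in>F'. \<nu> p * (c b q * c b' p - c b' q * c b p))"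
        unfolding S_def sum_distrib_left sum_subtractf[symmetric]
        by (intro sum.cong) (auto simp: algebra_simps)
      with \<nu> that show ?thesis by simp
    qed
    then have "\<forall>b'\<in>insert b B. (\<Sum>p\<in>F. \<mu> p * c b' p) = 0"
      unfolding sum by simp
    moreover have "\<exists>p\<in>F. \<mu> p \<noteq> 0" using \<nu>(1) q F by (auto simp: \<mu>_def)
    ultimately show ?thesis by blast
  qed
qed

text \<open>The ratio test of the simplex method, cross-multiplied: when \<open>w\<close> is moved
  against \<open>\<mu>\<close>, the weight at \<open>j\<close> reaches zero while no weight has
  become negative.\<close>

lemma minimal_ratio:
  fixes w \<mu> :: "'p \<Rightarrow> int"
  assumes "finite F" "\<forall>p\<in>F. w p \<ge> 0" "\<exists>p\<in>F. \<mu> p > 0"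
  shows "\<exists>j\<in>F. \<mu> j > 0 \<and> (\<forall>p\<in>F. w j * \<mu> p \<le> w p * \<mu> j)"
proof -
  let ?P = "{p\<in>F. \<mu> p > 0}"
  have "finite ?P" "?P \<noteq> {}" using assms by auto
  then obtain j where j: "j \<in> ?P" "\<forall>p\<in>?P. real_of_int (w j) / \<mu> j \<le> w p / \<mu> p"
    using arg_min_if_finite[of ?P "\<lambda>p. real_of_int (w p) / \<mu> p"]
    by (meson linorder_not_le)
  have "w j * \<mu> p \<le> w p * \<mu> j" if "p \<in> F" for p
  proof (cases "\<mu> p > 0")
    case True
    then have "real_of_int (w j) / \<mu> j \<le> w p / \<mu> p" using j that by blast
    then have "real_of_int (w j) * \<mu> p \<le> w p * \<mu> j"
      using True j(1) by (simp add: field_simps)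
    then show ?thesis by (metis of_int_le_iff of_int_mult)
  next
    case False
    then have "w j * \<mu> p \<le> 0" using j assms by (simp add: mult_nonneg_nonpos)
    also have "0 \<le> w p * \<mu> j" using j assms that by simp
    finally show ?thesis .
  qed
  then show ?thesis using j by blast
qed

text \<open>Weights below \<open>N\<close> would need at least \<open>d g + 1\<close> points in every class \<open>g\<close> with \<open>d g > 0\<close>.
  This exceeds by more than \<open>CARD('v) - 1\<close> the number of classes, so there is a relation between the
  points that preserves the class sums and all coordinates but \<open>v0\<close>; as the inequality for \<open>v0\<close> may
  become strict, one can move along this relation until a point disappears.\<close>

lemma concentrate_weights:
  fixes w :: "'p \<Rightarrow> int" and e :: "'p \<Rightarrow> 'v::finite \<Rightarrow> int" and grp :: "'p \<Rightarrow> 'g::finite"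
  assumes "finite F" "\<forall>p\<in>F. w p \<ge> 0" "N > 0"
    and "\<forall>g. (\<Sum>p\<in>F. w p * of_bool (grp p = g)) = N * int (d g)"
    and "\<forall>v. (\<Sum>p\<in>F. w p * e p v) \<le> N * a v"
    and card: "CARD('v) \<le> (\<Sum>g\<in>UNIV. d g)"
  shows "\<exists>N w p. N > 0 \<and> p \<in> F \<and> N \<le> w p \<and> (\<forall>p\<in>F. w p \<ge> 0) \<and>
    (\<forall>g. (\<Sum>p\<in>F. w p * of_bool (grp p = g)) = N * int (d g)) \<and>
    (\<forall>v. (\<Sum>p\<in>F. w p * e p v) \<le> N * a v)"
  using assms(1-5)
proof (induction "card F" arbitrary: F w N rule: less_induct)
  case less
  note [simp del] = sum_mult_of_bool_eq sum_of_bool_mult_eq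
  \<comment> \<open>Only the ratios of the weights to \<open>N\<close> matter, so both may be
    rescaled. A point of weight zero is deleted, and the weights found for the rest are extended by
    zero.\<close>
  have drop: ?case if w': "q \<in> F" "w' q = 0" "\<forall>p\<in>F. w' p \<ge> 0" "N' > 0"
    "\<forall>g. (\<Sum>p\<in>F. w' p * of_bool (grp p = g)) = N' * int (d g)"
    "\<forall>v. (\<Sum>p\<in>F. w' p * e p v) \<le> N' * a v" for q w' N'
  proof -
    have F: "sum h F = h q + sum h (F - {q})" for h :: "'p \<Rightarrow> int"
      using less.prems w' by (simp add: sum.remove)
    have "card (F - {q}) < card F" using w'(1) less.prems(1) by (rule card_Diff1_less[rotated])
    from less.hyps[OF this, of w' N'] w' less.prems(1)
    obtain M u p where u: "M > 0" "p \<in> F - {q}" "M \<le> u p" "\<forall>p\<in>F - {q}. u p \<ge> 0"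
      "\<forall>g. (\<Sum>p\<in>F - {q}. u p * of_bool (grp p = g)) = M * int (d g)"
      "\<forall>v. (\<Sum>p\<in>F - {q}. u p * e p v) \<le> M * a v"
      by (auto simp: F)
    have "(\<Sum>p\<in>F. (u(q := 0)) p * h p) = (\<Sum>p\<in>F - {q}. u p * h p)" for h :: "'p \<Rightarrow> int"
      unfolding F by (auto intro!: sum.cong)
    with u show ?thesis
      by (intro exI[of _ M] exI[of _ "u(q := 0)"] exI[of _ p]) auto
  qed
  show ?case
  proof (cases "(\<exists>p\<in>F. N \<le> w p) \<or> (\<exists>p\<in>F. w p = 0)")
    case True
    then show ?thesis
    proof
      assume "\<exists>p\<in>F. N \<le> w p"
      then show ?thesis using less.prems by blast
    next
      assume "\<exists>p\<in>F. w p = 0"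
      then show ?thesis using drop[of _ w N] less.prems by blast
    qed
  next
    case False
    then have w: "0 < w p" "w p < N" if "p \<in> F" for p
      using that less.prems(2) by force+
    define G where "G = {g. d g > 0}"
    define Fg where "Fg g = {p\<in>F. grp p = g}" for g
    have fin: "finite (Fg g)" for g using less.prems by (simp add: Fg_def)
    have restrict: "(\<Sum>p\<in>F. h p * of_bool (grp p = g)) = sum h (Fg g)" for h :: "'p \<Rightarrow> int" and g
    proof -
      have "(\<Sum>p\<in>F. h p * of_bool (grp p = g)) = (\<Sum>p\<in>F. if grp p = g then h p else 0)"
        by (intro sum.cong) auto
      also have "\<dots> = sum h (Fg g)"
        unfolding Fg_def by (rule sum.inter_filter[symmetric]) (use less.prems in auto)
      finally show ?thesis .
    qed
    have sumw: "sum w (Fg g) = N * int (d g)" for g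
      using less.prems(4) restrict by metis
    \<comment> \<open>All weights are positive by now, so a class of degree zero contains no
      point.\<close>
    have in_G: "grp p \<in> G" if "p \<in> F" for p
    proof -
      have "0 < sum w (Fg (grp p))"
        using that fin by (intro sum_pos) (auto simp: Fg_def w)
      then show ?thesis
        unfolding sumw G_def using less.prems(3) by (simp add: zero_less_mult_iff)
    qed
    have big: "d g + 1 \<le> card (Fg g)" if "g \<in> G" for g
    proof -
      have "0 < N * int (d g)" using that less.prems(3) by (simp add: G_def)
      then have "Fg g \<noteq> {}" using sumw[of g] by (metis less_irrefl sum.empty)
      then have "sum w (Fg g) < (\<Sum>p\<in>Fg g. N)"
        using fin by (intro sum_strict_mono) (auto simp: Fg_def w)
      then have "N * int (d g) < N * int (card (Fg g))"
        unfolding sumw by (simp add: mult.commute)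
      then show ?thesis using less.prems(3) by simp
    qed
    obtain v0 :: 'v where True by blast
    let ?B = "(UNIV - {v0}) <+> G"
    define c where "c b p = (case b of Inl v \<Rightarrow> e p v | Inr g \<Rightarrow> of_bool (grp p = g))" for b p
    have "card ?B < CARD('v) + card G"
      by (simp add: card_Plus card_Diff_singleton card_gt_0_iff)
    also have "\<dots> \<le> (\<Sum>g\<in>UNIV. d g) + card G" using card by simp
    also have "(\<Sum>g\<in>UNIV. d g) = (\<Sum>g\<in>G. d g)"
      by (intro sum.mono_neutral_right) (auto simp: G_def)
    also have "(\<Sum>g\<in>G. d g) + card G = (\<Sum>g\<in>G. d g + 1)" by (simp only: sum.distrib) simp
    also have "\<dots> \<le> (\<Sum>g\<in>G. card (Fg g))" by (intro sum_mono big)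
    also have "\<dots> = card (\<Union>g\<in>G. Fg g)"
      by (intro card_UN_disjoint[symmetric]) (auto simp: fin, auto simp: Fg_def)
    also have "(\<Union>g\<in>G. Fg g) = F" using in_G by (auto simp: Fg_def)
    finally have "card ?B < card F" .
    from homogeneous_system_nontrivial[OF _ less.prems(1) this, of c]
    obtain \<nu> where \<nu>: "\<exists>p\<in>F. \<nu> p \<noteq> 0" "\<forall>b\<in>?B. (\<Sum>p\<in>F. \<nu> p * c b p) = 0" by auto
    \<comment> \<open>The sign is chosen so that subtracting a positive multiple of
      \<open>\<mu>\<close> cannot raise the sum for \<open>v0\<close>, the only coordinate that the
      relation does not fix.\<close>
    define s where "s = (if (\<Sum>p\<in>F. \<nu> p * e p v0) \<ge> 0 then 1 else - 1 :: int)"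
    define \<mu> where "\<mu> p = s * \<nu> p" for p
    have \<mu>: "(\<Sum>p\<in>F. \<mu> p * h p) = s * (\<Sum>p\<in>F. \<nu> p * h p)" for h :: "'p \<Rightarrow> int"
      by (simp add: \<mu>_def sum_distrib_left mult.assoc)
    have \<mu>0: "\<exists>p\<in>F. \<mu> p \<noteq> 0" using \<nu>(1) by (simp add: \<mu>_def s_def)
    have \<mu>B: "\<forall>b\<in>?B. (\<Sum>p\<in>F. \<mu> p * c b p) = 0"
      unfolding \<mu> using \<nu>(2) by simp
    have \<mu>g: "(\<Sum>p\<in>F. \<mu> p * of_bool (grp p = g)) = 0" for g
    proof (cases "g \<in> G")
      case True
      then show ?thesis using bspec[OF \<mu>B, of "Inr g"] by (simp add: c_def InrI)
    next
      case False
      then show ?thesis using in_G by (intro sum.neutral) auto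
    qed
    have \<mu>v: "(\<Sum>p\<in>F. \<mu> p * e p v) \<ge> 0" for v
    proof (cases "v = v0")
      case True
      then show ?thesis unfolding \<mu> by (simp add: s_def)
    next
      case False
      then show ?thesis using bspec[OF \<mu>B, of "Inl v"] by (simp add: c_def InlI)
    qed
    \<comment> \<open>Without a positive entry, the class of a nonzero entry would have a negative
      sum, contrary to \<open>\<mu>g\<close>.\<close>
    have "\<exists>p\<in>F. \<mu> p > 0"
    proof (rule ccontr)
      assume *: "\<not> ?thesis"
      from \<mu>0 obtain q where q: "q \<in> F" "\<mu> q \<noteq> 0" by blast
      have "sum \<mu> (Fg (grp q)) < (\<Sum>p\<in>Fg (grp q). 0)"
      proof (rule sum_strict_mono_ex1)
        show "\<exists>p\<in>Fg (grp q). \<mu> p < 0"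
          using q * by (intro bexI[of _ q]) (auto simp: Fg_def not_less)
      qed (use * fin in \<open>auto simp: Fg_def not_less\<close>)
      then show False using \<mu>g[of "grp q"] by (simp add: restrict)
    qed
    then obtain j where j: "j \<in> F" "\<mu> j > 0" "\<forall>p\<in>F. w j * \<mu> p \<le> w p * \<mu> j"
      using minimal_ratio[of F w \<mu>] less.prems by blast
    \<comment> \<open>Scaling by \<open>\<mu> j\<close> avoids fractions: the new weights vanish at
      \<open>j\<close> and belong to the multiplier \<open>\<mu> j * N\<close>.\<close>
    define w' where "w' p = w p * \<mu> j - w j * \<mu> p" for p
    have w': "(\<Sum>p\<in>F. w' p * h p) = \<mu> j * (\<Sum>p\<in>F. w p * h p) - w j * (\<Sum>p\<in>F. \<mu> p * h p)"
      for h :: "'p \<Rightarrow> int"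
      unfolding w'_def sum_distrib_left sum_subtractf[symmetric]
      by (intro sum.cong) (auto simp: algebra_simps)
    show ?thesis
    proof (rule drop[of j w' "\<mu> j * N"])
      show "\<forall>g. (\<Sum>p\<in>F. w' p * of_bool (grp p = g)) = \<mu> j * N * int (d g)"
        unfolding w' \<mu>g using less.prems(4) by simp
      show "\<forall>v. (\<Sum>p\<in>F. w' p * e p v) \<le> \<mu> j * N * a v"
      proof
        fix v
        have "\<mu> j * (\<Sum>p\<in>F. w p * e p v) \<le> \<mu> j * (N * a v)"
          using less.prems(5) j by (intro mult_left_mono) auto
        moreover have "0 \<le> w j * (\<Sum>p\<in>F. \<mu> p * e p v)" using w[OF j(1)] \<mu>v by simp
        ultimately show "(\<Sum>p\<in>F. w' p * e p v) \<le> \<mu> j * N * a v"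
          unfolding w' by (simp add: mult.assoc)
      qed
    qed (use j less.prems in \<open>auto simp: w'_def\<close>)
  qed
qed

section \<open>Exponents of products of monomial ideals\<close>

text \<open>For exponent sets \<open>A g\<close> of monomial generators of ideals \<open>I g\<close>, this is the set of exponents
  of the monomials in the product of the powers \<open>I g ^ d g\<close>.\<close>

definition product_exponents ::
    "('g \<Rightarrow> ('v \<Rightarrow>\<^sub>0 nat) set) \<Rightarrow> ('g \<Rightarrow> nat) \<Rightarrow> ('v \<Rightarrow>\<^sub>0 nat) set" where
  "product_exponents A d = {x. \<exists>m. (\<forall>p\<in>#m. snd p \<in> A (fst p)) \<and>
     (\<forall>g. size (filter_mset (\<lambda>p. fst p = g) m) = d g) \<and>
     (\<forall>v. (\<Sum>p\<in>#m. lookup (snd p) v) \<le> lookup x v)}"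

lemma product_exponents_zero: "product_exponents A (\<lambda>_. 0) = UNIV"
  by (auto simp: product_exponents_def intro: exI[of _ "{#}"])

lemma product_exponents_single:
  "product_exponents A (\<lambda>h. of_bool (h = g)) = {e + c | e c. e \<in> A g}" (is "?L = ?R")
proof (intro equalityI subsetI)
  fix x assume "x \<in> ?R"
  then obtain e c where "x = e + c" "e \<in> A g" by blast
  then show "x \<in> ?L"
    by (auto simp: product_exponents_def lookup_add intro!: exI[of _ "{#(g, e)#}"])
next
  fix x assume "x \<in> ?L"
  then obtain m where m: "\<forall>p\<in>#m. snd p \<in> A (fst p)"
    "\<forall>h. size (filter_mset (\<lambda>p. fst p = h) m) = of_bool (h = g)"
    "\<forall>v. (\<Sum>p\<in>#m. lookup (snd p) v) \<le> lookup x v"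
    by (auto simp: product_exponents_def)
  have "size (filter_mset (\<lambda>p. fst p = g) m) = 1" using m(2) by simp
  then have "filter_mset (\<lambda>p. fst p = g) m \<noteq> {#}" by (metis size_empty zero_neq_one)
  then obtain p where p: "p \<in># m" "fst p = g" by (auto elim: multiset_nonemptyE)
  obtain m' where m': "m = add_mset p m'" using multi_member_split[OF p(1)] by blast
  have "lookup (snd p) v \<le> lookup x v" for v
    using add_leD1[of "lookup (snd p) v" _ "lookup x v"] spec[OF m(3), of v] by (simp add: m')
  then have "x = snd p + (x - snd p)"
    by (intro poly_mapping_eqI) (simp add: lookup_add lookup_minus)
  then show "x \<in> ?R" using p m(1) by blast
qed

lemma product_exponents_add:
  assumes "x \<in> product_exponents A d" "y \<in> product_exponents A d'"
  shows "x + y \<in> product_exponents A (\<lambda>g. d g + d' g)"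
proof -
  from assms obtain m m' where
    "\<forall>p\<in>#m. snd p \<in> A (fst p)" "\<forall>h. size (filter_mset (\<lambda>p. fst p = h) m) = d h"
    "\<forall>v. (\<Sum>p\<in>#m. lookup (snd p) v) \<le> lookup x v"
    "\<forall>p\<in>#m'. snd p \<in> A (fst p)" "\<forall>h. size (filter_mset (\<lambda>p. fst p = h) m') = d' h"
    "\<forall>v. (\<Sum>p\<in>#m'. lookup (snd p) v) \<le> lookup y v"
    by (auto simp: product_exponents_def)
  then show ?thesis
    unfolding product_exponents_def
    by (intro CollectI exI[of _ "m + m'"]) (auto simp: lookup_add simp del: split_paired_All intro: add_mono)
qed

lemma product_exponents_up: "x \<in> product_exponents A d \<Longrightarrow> x + c \<in> product_exponents A d"
  using product_exponents_add[of x A d c "\<lambda>_. 0"] by (simp add: product_exponents_zero)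

lemma product_exponents_split1:
  assumes "x \<in> product_exponents A d" "d g > 0"
  obtains e y where "x = e + y" "e \<in> A g" "y \<in> product_exponents A (d(g := d g - 1))"
proof -
  from assms obtain m where m: "\<forall>p\<in>#m. snd p \<in> A (fst p)"
    "\<forall>h. size (filter_mset (\<lambda>p. fst p = h) m) = d h"
    "\<forall>v. (\<Sum>p\<in>#m. lookup (snd p) v) \<le> lookup x v"
    by (auto simp: product_exponents_def)
  have "filter_mset (\<lambda>p. fst p = g) m \<noteq> {#}" using m(2) assms(2) by (metis less_irrefl size_empty)
  then obtain p where p: "p \<in># m" "fst p = g" by (auto elim: multiset_nonemptyE)
  obtain m' where m': "m = add_mset p m'" using multi_member_split[OF p(1)] by blast
  have le: "lookup (snd p) v + (\<Sum>p\<in>#m'. lookup (snd p) v) \<le> lookup x v" for v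
    using m(3) by (simp add: m')
  have "x = snd p + (x - snd p)"
    using add_leD1[OF le] by (intro poly_mapping_eqI) (simp add: lookup_add lookup_minus)
  moreover have "x - snd p \<in> product_exponents A (d(g := d g - 1))"
    unfolding product_exponents_def mem_Collect_eq
  proof (intro exI[of _ m'] conjI allI)
    fix h show "size (filter_mset (\<lambda>p. fst p = h) m') = (d(g := d g - 1)) h"
      using spec[OF m(2), of h] p by (auto simp: m' split: if_splits)
  next
    fix v show "(\<Sum>p\<in>#m'. lookup (snd p) v) \<le> lookup (x - snd p) v"
      using le[of v] by (simp add: lookup_minus)
  qed (use m(1) in \<open>simp add: m'\<close>)
  ultimately show thesis using that m(1) p by blast
qed

text \<open>The generators counted by \<open>d\<close> are peeled off one at a time, and the excess
  of \<open>x\<close> over its generators passes to \<open>z\<close>. Together with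
  \<open>product_exponents_add\<close> this makes products of ideals correspond to sums of degree
  functions.\<close>

lemma product_exponents_split:
  fixes d d' :: "'g::finite \<Rightarrow> nat"
  assumes "x \<in> product_exponents A (\<lambda>g. d g + d' g)"
  shows "\<exists>y\<in>product_exponents A d. \<exists>z\<in>product_exponents A d'. x = y + z"
  using assms
proof (induction "sum d UNIV" arbitrary: d x)
  case 0
  then have "d = (\<lambda>_. 0)" by (auto simp: fun_eq_iff)
  then show ?case using 0 by (intro bexI[of _ 0] bexI[of _ x]) (auto simp: product_exponents_zero)
next
  case (Suc n)
  have "sum d UNIV \<noteq> 0" unfolding Suc(2)[symmetric] by simp
  then obtain g where g: "d g > 0" by (auto simp: sum_eq_0_iff)
  let ?d = "d(g := d g - 1)"
  have "sum d UNIV = d g + sum d (UNIV - {g})" "sum ?d UNIV = d g - 1 + sum d (UNIV - {g})"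
    by (simp_all add: sum.remove[of UNIV g])
  then have n: "n = sum ?d UNIV" using Suc(2) g by simp
  obtain e y where y: "x = e + y" "e \<in> A g"
    "y \<in> product_exponents A ((\<lambda>g. d g + d' g)(g := d g + d' g - 1))"
    using product_exponents_split1[OF Suc.prems, of g] g by auto
  have "(\<lambda>g. d g + d' g)(g := d g + d' g - 1) = (\<lambda>h. ?d h + d' h)" using g by auto
  then obtain u w where u: "u \<in> product_exponents A ?d" "w \<in> product_exponents A d'" "y = u + w"
    using Suc.hyps(1)[OF n, of y] y by auto
  have "e \<in> product_exponents A (\<lambda>h. of_bool (h = g))"
    unfolding product_exponents_single using y(2) by (intro CollectI exI[of _ e] exI[of _ 0] conjI) simp_all
  from product_exponents_add[OF this u(1)]
  have "e + u \<in> product_exponents A (\<lambda>h. of_bool (h = g) + ?d h)" .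
  also have "(\<lambda>h. of_bool (h = g) + ?d h) = d" using g by (auto simp: fun_eq_iff)
  finally show ?case using u y by (metis add.assoc)
qed

lemma superadditive_product_exponents: "superadditive (\<lambda>k. product_exponents A (\<lambda>g. k * d g))"
  unfolding superadditive_def
proof (intro conjI allI ballI)
  fix k l x y assume "x \<in> product_exponents A (\<lambda>g. k * d g)" "y \<in> product_exponents A (\<lambda>g. l * d g)"
  from product_exponents_add[OF this]
  show "x + y \<in> product_exponents A (\<lambda>g. (k + l) * d g)" by (simp add: distrib_right)
qed (simp add: product_exponents_zero)

text \<open>The lattice points of the Newton polyhedron of the product ideal: the saturation in
  degree 1 of the family formed by its powers.\<close>

definition saturated_exponents ::
    "('g \<Rightarrow> ('v \<Rightarrow>\<^sub>0 nat) set) \<Rightarrow> ('g \<Rightarrow> nat) \<Rightarrow> ('v \<Rightarrow>\<^sub>0 nat) set" where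
  "saturated_exponents A d = {x. \<exists>N>0. scale N x \<in> product_exponents A (\<lambda>g. N * d g)}"

text \<open>Multiplicities of generators, divided by \<open>N\<close>, are the weights of
  \<open>x\<close>. After \<open>concentrate_weights\<close>, some generator \<open>(g, e)\<close>
  has multiplicity at least the new multiplier \<open>L\<close>; taking out \<open>L\<close> copies
  of it subtracts exactly \<open>e\<close> from \<open>x\<close> and 1 from
  \<open>d g\<close>.\<close>

lemma saturated_exponents_split1:
  fixes A :: "'g::finite \<Rightarrow> ('v::finite \<Rightarrow>\<^sub>0 nat) set"
  assumes x: "x \<in> saturated_exponents A d" and card: "CARD('v) \<le> sum d UNIV"
  obtains g e y where "d g > 0" "x = e + y" "e \<in> A g" "y \<in> saturated_exponents A (d(g := d g - 1))"
proof -
  obtain N m where N: "N > 0" and m: "\<forall>p\<in>#m. snd p \<in> A (fst p)"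
    "\<forall>h. size (filter_mset (\<lambda>p. fst p = h) m) = N * d h"
    "\<forall>v. (\<Sum>p\<in>#m. lookup (snd p) v) \<le> N * lookup x v"
    using x by (auto simp: saturated_exponents_def product_exponents_def)
  define F where "F = set_mset m"
  have sum_m: "(\<Sum>p\<in>#m'. f p) = (\<Sum>p\<in>F. count m' p * f p)"
    if "set_mset m' \<subseteq> F" for f :: "'g \<times> ('v \<Rightarrow>\<^sub>0 nat) \<Rightarrow> nat" and m'
    using that
  proof (induction m')
    case (add q m')
    have "(\<Sum>p\<in>F. count (add_mset q m') p * f p)
        = (\<Sum>p\<in>F. count m' p * f p + (if p = q then f p else 0))"
      by (intro sum.cong) auto
    also have "\<dots> = (\<Sum>p\<in>F. count m' p * f p) + f q"
      using add.prems by (simp add: sum.distrib F_def)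
    finally show ?case using add by simp
  qed simp
  have size_m: "size (filter_mset (\<lambda>p. fst p = g) m') = (\<Sum>p\<in>F. count m' p * of_bool (fst p = g))"
    if "set_mset m' \<subseteq> F" for g m'
  proof -
    have "size (filter_mset (\<lambda>p. fst p = g) m') = (\<Sum>p\<in>#m'. of_bool (fst p = g))"
      by (induction m') auto
    with sum_m[OF that] show ?thesis by simp
  qed
  note [simp del] = sum_mult_of_bool_eq sum_of_bool_mult_eq
  have "\<exists>M w p. M > 0 \<and> p \<in> F \<and> M \<le> w p \<and> (\<forall>p\<in>F. w p \<ge> 0) \<and>
    (\<forall>g. (\<Sum>p\<in>F. w p * of_bool (fst p = g)) = M * int (d g)) \<and>
    (\<forall>v. (\<Sum>p\<in>F. w p * int (lookup (snd p) v)) \<le> M * int (lookup x v))"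
  proof (rule concentrate_weights[where w = "\<lambda>p. int (count m p)" and N = "int N"])
    show "\<forall>g. (\<Sum>p\<in>F. int (count m p) * of_bool (fst p = g)) = int N * int (d g)"
    proof
      fix g
      have "int (\<Sum>p\<in>F. count m p * of_bool (fst p = g)) = int (N * d g)"
        using m(2) size_m[of m g] by (simp add: F_def)
      then show "(\<Sum>p\<in>F. int (count m p) * of_bool (fst p = g)) = int N * int (d g)" by simp
    qed
    show "\<forall>v. (\<Sum>p\<in>F. int (count m p) * int (lookup (snd p) v)) \<le> int N * int (lookup x v)"
    proof
      fix v
      have "int (\<Sum>p\<in>F. count m p * lookup (snd p) v) \<le> int (N * lookup x v)"
        using spec[OF m(3), of v] sum_m[of m "\<lambda>p. lookup (snd p) v"]
        by (simp only: of_nat_le_iff F_def)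
      then show "(\<Sum>p\<in>F. int (count m p) * int (lookup (snd p) v)) \<le> int N * int (lookup x v)"
        by simp
    qed
  qed (use N card in \<open>auto simp: F_def\<close>)
  then obtain M w p where w: "M > 0" "p \<in> F" "M \<le> w p" "\<forall>p\<in>F. w p \<ge> 0"
    "\<forall>g. (\<Sum>p\<in>F. w p * of_bool (fst p = g)) = M * int (d g)"
    "\<forall>v. (\<Sum>p\<in>F. w p * int (lookup (snd p) v)) \<le> M * int (lookup x v)"
    by blast
  obtain g e where p: "p = (g, e)" by (cases p)
  define L where "L = nat M"
  \<comment> \<open>The integer weights are turned back into multiplicities; the value zero outside
    the finite set \<open>F\<close> makes this a multiset.\<close>
  define m' where "m' = Abs_multiset (\<lambda>q. if q \<in> F then nat (w q) else 0)"
  have count_m': "count m' q = (if q \<in> F then nat (w q) else 0)" for q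
    unfolding m'_def by (subst count_Abs_multiset) (auto simp: F_def)
  have m'F: "set_mset m' \<subseteq> F"
    by (auto simp: set_mset_def count_m' split: if_splits)
  have L: "L > 0" "int L = M" using w by (auto simp: L_def)
  have sum_w: "int (\<Sum>q\<in>F. count m' q * f q) = (\<Sum>q\<in>F. w q * int (f q))" for f
    using w(4) unfolding of_nat_sum by (intro sum.cong) (auto simp: count_m')
  have size': "size (filter_mset (\<lambda>p. fst p = h) m') = L * d h" for h
  proof -
    have "int (size (filter_mset (\<lambda>p. fst p = h) m')) = int (L * d h)"
      unfolding size_m[OF m'F] sum_w using w(5) L by simp
    then show ?thesis by (simp only: of_nat_eq_iff)
  qed
  have sum': "(\<Sum>q\<in>#m'. lookup (snd q) v) \<le> L * lookup x v" for v
  proof -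
    have "int (\<Sum>q\<in>#m'. lookup (snd q) v) \<le> int (L * lookup x v)"
      unfolding sum_m[OF m'F] sum_w using w(6) L by simp
    then show ?thesis by (simp only: of_nat_le_iff)
  qed
  have "L \<le> count m' p" using w by (simp add: count_m' L_def nat_mono)
  then have "replicate_mset L p \<subseteq># m'" by (simp add: count_le_replicate_mset_subset_eq)
  then obtain k where k: "m' = replicate_mset L p + k" by (metis subset_mset.le_iff_add)
  have size_repl: "size (filter_mset (\<lambda>p. fst p = h) (replicate_mset n (g, e))) = n * of_bool (g = h)"
    for h n by (induction n) auto
  have le: "L * lookup e v + (\<Sum>q\<in>#k. lookup (snd q) v) \<le> L * lookup x v" for v
    using sum'[of v] by (simp add: k p)
  have "lookup e v \<le> lookup x v" for v
    using add_leD1[OF le] L by simp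
  then have x_eq: "x = e + (x - e)"
    by (intro poly_mapping_eqI) (simp add: lookup_add lookup_minus)
  \<comment> \<open>The \<open>L\<close> removed copies all lie in class \<open>g\<close>, so its
    total \<open>L * d g\<close> is positive.\<close>
  have "L + size (filter_mset (\<lambda>p. fst p = g) k) = L * d g"
    using size'[of g] unfolding k p filter_union_mset size_union size_repl by simp
  then have dg: "d g > 0" using L by (cases "d g") auto
  have "scale L (x - e) \<in> product_exponents A (\<lambda>h. L * (d(g := d g - 1)) h)"
    unfolding product_exponents_def mem_Collect_eq
  proof (intro exI[of _ k] conjI allI ballI)
    fix q assume "q \<in># k"
    then show "snd q \<in> A (fst q)" using m'F m(1) by (auto simp: k F_def)
  next
    fix h show "size (filter_mset (\<lambda>p. fst p = h) k) = L * (d(g := d g - 1)) h"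
      using size'[of h] unfolding k p filter_union_mset size_union size_repl
      by (auto simp: diff_mult_distrib2)
  next
    fix v show "(\<Sum>q\<in>#k. lookup (snd q) v) \<le> lookup (scale L (x - e)) v"
      using le[of v] by (simp add: lookup_minus diff_mult_distrib2)
  qed
  then have "x - e \<in> saturated_exponents A (d(g := d g - 1))"
    using L by (auto simp: saturated_exponents_def)
  moreover have "e \<in> A g" using w(2) m(1) by (auto simp: F_def p)
  ultimately show thesis using that dg x_eq by blast
qed

section \<open>Monomial ideals\<close>

text \<open>The span of the monomials with exponent in \<open>S\<close>. For \<open>S\<close> closed
  under adding exponents this is a monomial ideal, so ideal operations can be computed on exponent
  sets.\<close>

definition supported :: "('v \<Rightarrow>\<^sub>0 nat) set \<Rightarrow> (('v \<Rightarrow>\<^sub>0 nat) \<Rightarrow>\<^sub>0 'k::field) set" where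
  "supported S = {f. keys f \<subseteq> S}"

lemma is_ideal_supported:
  assumes "\<And>s c. s \<in> S \<Longrightarrow> s + c \<in> S"
  shows "is_ideal (supported S :: (('v \<Rightarrow>\<^sub>0 nat) \<Rightarrow>\<^sub>0 'k::field) set)"
  unfolding is_ideal_iff
proof (intro conjI ballI allI)
  fix f g :: "('v \<Rightarrow>\<^sub>0 nat) \<Rightarrow>\<^sub>0 'k" assume "f \<in> supported S" "g \<in> supported S"
  then show "f + g \<in> supported S" using keys_add[of f g] by (auto simp: supported_def)
next
  fix c f :: "('v \<Rightarrow>\<^sub>0 nat) \<Rightarrow>\<^sub>0 'k" assume f: "f \<in> supported S"
  have "a + b \<in> S" if "b \<in> keys f" for a b
    using assms[of b a] that f by (auto simp: supported_def add.commute)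
  then show "c * f \<in> supported S" using keys_mult[of c f] unfolding supported_def by blast
qed (simp add: supported_def)

lemma is_ideal_mult: "is_ideal I \<Longrightarrow> a \<in> I \<Longrightarrow> c * a \<in> I"
  by (simp add: is_ideal_iff)

lemma ideal_gen_subset: "S \<subseteq> ideal_gen S"
  unfolding ideal_gen_def by (rule module.span_superset[OF module_times])

lemma ideal_gen_minimal: "S \<subseteq> I \<Longrightarrow> is_ideal I \<Longrightarrow> ideal_gen S \<subseteq> I"
  unfolding ideal_gen_def is_ideal_def by (rule module.span_minimal[OF module_times])

lemma ideal_contains_if_terms:
  fixes f :: "'a::monoid_add \<Rightarrow>\<^sub>0 'b::comm_ring_1" and I :: "('a \<Rightarrow>\<^sub>0 'b) set"
  assumes "0 \<in> I" "\<And>f g. f \<in> I \<Longrightarrow> g \<in> I \<Longrightarrow> f + g \<in> I"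
    and "\<And>a. a \<in> keys f \<Longrightarrow> Poly_Mapping.single a (lookup f a) \<in> I"
  shows "f \<in> I"
proof -
  have "f = (\<Sum>a\<in>keys f. Poly_Mapping.single a (lookup f a))"
    by (intro poly_mapping_eqI) (simp add: lookup_sum lookup_single when_def sum.delta in_keys_iff)
  moreover have "(\<Sum>a\<in>F. Poly_Mapping.single a (lookup f a)) \<in> I"
    if "finite F" "F \<subseteq> keys f" for F
    using that by (induction F rule: finite_induct) (auto intro: assms)
  ultimately show ?thesis by (metis finite_keys order_refl)
qed

lemma ideal_contains_supported:
  fixes I :: "(('v \<Rightarrow>\<^sub>0 nat) \<Rightarrow>\<^sub>0 'k::field) set"
  assumes "is_ideal I" "\<And>a. a \<in> S \<Longrightarrow> Poly_Mapping.single a 1 \<in> I"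
  shows "supported S \<subseteq> I"
proof
  fix f :: "('v \<Rightarrow>\<^sub>0 nat) \<Rightarrow>\<^sub>0 'k" assume f: "f \<in> supported S"
  show "f \<in> I"
  proof (rule ideal_contains_if_terms)
    fix a assume "a \<in> keys f"
    then have "Poly_Mapping.single a 1 \<in> I" using f assms(2) by (auto simp: supported_def)
    then have "Poly_Mapping.single 0 (lookup f a) * Poly_Mapping.single a 1 \<in> I"
      by (rule is_ideal_mult[OF assms(1)])
    then show "Poly_Mapping.single a (lookup f a) \<in> I" by (simp add: mult_single)
  qed (use assms(1) in \<open>auto simp: is_ideal_iff\<close>)
qed

lemma ideal_gen_monomials:
  "ideal_gen ((\<lambda>e. Poly_Mapping.single e 1) ` E)
    = (supported {e + c | e c. e \<in> E} :: (('v \<Rightarrow>\<^sub>0 nat) \<Rightarrow>\<^sub>0 'k::field) set)" (is "?L = ?R")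
proof
  have "is_ideal ?R"
  proof (rule is_ideal_supported)
    fix x c assume "x \<in> {e + c | e c. e \<in> E}"
    then obtain e c' where "x = e + c'" "e \<in> E" by blast
    then show "x + c \<in> {e + c | e c. e \<in> E}"
      by (intro CollectI exI[of _ e] exI[of _ "c' + c"]) (simp add: add.assoc)
  qed
  moreover have "e \<in> {e + c | e c. e \<in> E}" if "e \<in> E" for e
    using that by (intro CollectI exI[of _ e] exI[of _ 0] conjI) simp_all
  then have "(\<lambda>e. Poly_Mapping.single e 1) ` E \<subseteq> ?R"
    by (auto simp: supported_def)
  ultimately show "?L \<subseteq> ?R" by (rule ideal_gen_minimal[rotated])
  show "?R \<subseteq> ?L"
  proof (rule ideal_contains_supported[OF is_ideal_ideal_gen])
    fix a assume "a \<in> {e + c | e c. e \<in> E}"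
    then obtain e c where a: "a = e + c" "e \<in> E" by blast
    have "Poly_Mapping.single e 1 \<in> ?L" using a(2) by (intro subsetD[OF ideal_gen_subset]) simp
    then have "Poly_Mapping.single c 1 * Poly_Mapping.single e 1 \<in> ?L"
      by (rule is_ideal_mult[OF is_ideal_ideal_gen])
    then show "Poly_Mapping.single a 1 \<in> ?L"
      unfolding a(1) by (simp add: mult_single add.commute)
  qed
qed

lemma ideal_mult_memI: "a \<in> I \<Longrightarrow> b \<in> J \<Longrightarrow> a * b \<in> ideal_mult I J"
  unfolding ideal_mult_def by (rule subsetD[OF ideal_gen_subset]) blast

lemma ideal_mult_minimal:
  "(\<And>a b. a \<in> I \<Longrightarrow> b \<in> J \<Longrightarrow> a * b \<in> L) \<Longrightarrow> is_ideal L \<Longrightarrow> ideal_mult I J \<subseteq> L"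
  unfolding ideal_mult_def by (rule ideal_gen_minimal) auto

lemma ideal_mult_supported:
  fixes S T :: "('v \<Rightarrow>\<^sub>0 nat) set"
  assumes "\<And>t c. t \<in> T \<Longrightarrow> t + c \<in> T"
  shows "ideal_mult (supported S) (supported T)
    = (supported {s + t | s t. s \<in> S \<and> t \<in> T} :: (('v \<Rightarrow>\<^sub>0 nat) \<Rightarrow>\<^sub>0 'k::field) set)" (is "?L = ?R")
proof
  show "?L \<subseteq> ?R"
  proof (rule ideal_mult_minimal)
    fix f g :: "('v \<Rightarrow>\<^sub>0 nat) \<Rightarrow>\<^sub>0 'k" assume "f \<in> supported S" "g \<in> supported T"
    then have "keys f \<subseteq> S" "keys g \<subseteq> T" by (simp_all add: supported_def)
    then have "{a + b | a b. a \<in> keys f \<and> b \<in> keys g} \<subseteq> {s + t | s t. s \<in> S \<and> t \<in> T}" by blast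
    then show "f * g \<in> ?R"
      unfolding supported_def using keys_mult[of f g] by simp
  next
    show "is_ideal ?R"
    proof (rule is_ideal_supported)
      fix x c assume "x \<in> {s + t | s t. s \<in> S \<and> t \<in> T}"
      then obtain s t where "x = s + t" "s \<in> S" "t \<in> T" by blast
      then show "x + c \<in> {s + t | s t. s \<in> S \<and> t \<in> T}"
        using assms by (intro CollectI exI[of _ s] exI[of _ "t + c"]) (simp add: add.assoc)
    qed
  qed
  show "?R \<subseteq> ?L"
  proof (rule ideal_contains_supported)
    show "is_ideal ?L" unfolding ideal_mult_def by (rule is_ideal_ideal_gen)
  next
    fix a assume "a \<in> {s + t | s t. s \<in> S \<and> t \<in> T}"
    then obtain s t where a: "a = s + t" "s \<in> S" "t \<in> T" by blast
    have "Poly_Mapping.single s (1::'k) * Poly_Mapping.single t 1 \<in> ?L"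
      using a(2,3) by (intro ideal_mult_memI) (simp_all add: supported_def)
    then show "Poly_Mapping.single a 1 \<in> ?L"
      by (simp add: a(1) mult_single)
  qed
qed

section \<open>Products of powers: multiplication, integral closure, completeness\<close>

abbreviation product_ideal ::
    "('g::finite \<Rightarrow> ('v \<Rightarrow>\<^sub>0 nat) set) \<Rightarrow> ('g \<Rightarrow> nat) \<Rightarrow> (('v \<Rightarrow>\<^sub>0 nat) \<Rightarrow>\<^sub>0 'k::field) set" where
  "product_ideal A d \<equiv> supported (product_exponents A d)"

lemma product_ideal_mult:
  "ideal_mult (product_ideal A d) (product_ideal A d') = product_ideal A (\<lambda>g. d g + d' g)"
proof -
  have "{x + y | x y. x \<in> product_exponents A d \<and> y \<in> product_exponents A d'}
      = product_exponents A (\<lambda>g. d g + d' g)"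
    by (intro equalityI subsetI)
      (use product_exponents_add in blast, use product_exponents_split[of _ A d d'] in blast)
  then show ?thesis
    by (subst ideal_mult_supported) (auto intro: product_exponents_up)
qed

lemma product_ideal_power: "ideal_power (product_ideal A d) n = product_ideal A (\<lambda>g. n * d g)"
proof (induction n)
  case 0
  then show ?case by (simp add: product_exponents_zero supported_def)
next
  case (Suc n)
  then show ?case by (simp add: product_ideal_mult)
qed

lemma product_ideal_integral_closure:
  "integral_closure (product_ideal A d) \<subseteq> supported (saturated_exponents A d)"
proof
  fix f assume "f \<in> integral_closure (product_ideal A d)"
  then obtain n c where n: "n > 0" "\<forall>i\<in>{1..n}. c i \<in> ideal_power (product_ideal A d) i"
    "f ^ n + (\<Sum>i=1..n. c i * f ^ (n - i)) = 0"
    unfolding integral_closure_def integral_over_ideal_def by blast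
  have "keys f \<subseteq> saturation (\<lambda>k. product_exponents A (\<lambda>g. k * d g)) 1"
  proof (rule keys_integral_subset_saturation[OF superadditive_product_exponents n(1) _ n(3)])
    show "\<forall>i\<in>{1..n}. keys (c i) \<subseteq> product_exponents A (\<lambda>g. i * d g)"
      using n(2)[unfolded product_ideal_power] by (simp add: supported_def)
  qed
  then show "f \<in> supported (saturated_exponents A d)"
    by (simp add: supported_def saturation_def saturated_exponents_def)
qed

lemma single_power: "Poly_Mapping.single a (1::'k::field) ^ n = Poly_Mapping.single (scale n a) 1"
  by (induction n) (simp_all add: scale_Suc mult_single)

lemma single_in_integral_closure:
  assumes "a \<in> saturated_exponents A d"
  shows "Poly_Mapping.single a (1::'k::field) \<in> integral_closure (product_ideal A d)"
proof -
  let ?x = "Poly_Mapping.single a (1::'k)"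
  obtain N where N: "N > 0" "scale N a \<in> product_exponents A (\<lambda>g. N * d g)"
    using assms unfolding saturated_exponents_def by blast
  \<comment> \<open>The equation is \<open>T ^ N - ?x ^ N = 0\<close>: only its last coefficient is
    nonzero, and it lies in the \<open>N\<close>-th power by the choice of \<open>N\<close>.\<close>
  define c where "c i = (if i = N then - (?x ^ N) else 0)" for i
  have "\<forall>i\<in>{1..N}. c i \<in> ideal_power (product_ideal A d) i"
    unfolding product_ideal_power using N(2) by (auto simp: supported_def c_def single_power)
  moreover have "(\<Sum>i=1..N. c i * ?x ^ (N - i)) = (\<Sum>i=1..N. if i = N then - (?x ^ N) else 0)"
    by (intro sum.cong) (auto simp: c_def)
  then have "?x ^ N + (\<Sum>i=1..N. c i * ?x ^ (N - i)) = 0"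
    using N(1) by simp
  ultimately show ?thesis
    using N(1) unfolding integral_closure_def integral_over_ideal_def by blast
qed

lemma subset_integral_closure: "I \<subseteq> integral_closure I"
proof
  fix f assume f: "f \<in> I"
  \<comment> \<open>The equation of degree one is \<open>f + (- f) = 0\<close>. The first power
    unfolds to the product of \<open>I\<close> with the whole ring, hence the factor
    \<open>- 1\<close>.\<close>
  have "f * - 1 \<in> ideal_mult I UNIV" by (rule ideal_mult_memI[OF f UNIV_I])
  then have "- f \<in> ideal_power I 1" by simp
  then show "f \<in> integral_closure I"
    unfolding integral_closure_def integral_over_ideal_def
    by (intro CollectI exI[of _ 1] exI[of _ "\<lambda>_. - f"] conjI) simp_all
qed

text \<open>Completeness amounts to \<open>sat\<close>, a statement about exponents alone, which
  admits induction on the total degree. The hypothesis enters in degrees below the number of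
  variables, where it is applied to single monomials.\<close>

lemma complete_product_ideals:
  fixes A :: "'g::finite \<Rightarrow> ('v::finite \<Rightarrow>\<^sub>0 nat) set"
  assumes complete: "\<And>d. sum d UNIV < CARD('v) \<Longrightarrow>
    complete_ideal (product_ideal A d :: (('v \<Rightarrow>\<^sub>0 nat) \<Rightarrow>\<^sub>0 'k::field) set)"
  shows "complete_ideal (product_ideal A d :: (('v \<Rightarrow>\<^sub>0 nat) \<Rightarrow>\<^sub>0 'k) set)"
proof -
  have sat: "saturated_exponents A d \<subseteq> product_exponents A d"
  proof (induction "sum d UNIV" arbitrary: d rule: less_induct)
    case less
    show ?case
    proof
      fix a assume a: "a \<in> saturated_exponents A d"
      show "a \<in> product_exponents A d"
      proof (cases "sum d UNIV < CARD('v)")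
        case True
        then have "Poly_Mapping.single a (1::'k) \<in> product_ideal A d"
          using complete[OF True] single_in_integral_closure[OF a] unfolding complete_ideal_def by blast
        then show ?thesis by (simp add: supported_def)
      next
        case False
        then obtain g e y where g: "d g > 0" "a = e + y" "e \<in> A g"
          "y \<in> saturated_exponents A (d(g := d g - 1))"
          using saturated_exponents_split1[OF a] by (metis not_le)
        let ?d = "d(g := d g - 1)"
        have "sum d UNIV = d g + sum d (UNIV - {g})" "sum ?d UNIV = d g - 1 + sum d (UNIV - {g})"
          by (simp_all add: sum.remove[of UNIV g])
        then have "sum ?d UNIV < sum d UNIV" using g(1) by simp
        then have y: "y \<in> product_exponents A ?d" using less g(4) by blast
        have "e \<in> product_exponents A (\<lambda>h. of_bool (h = g))"
          unfolding product_exponents_single using g(3)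
          by (intro CollectI exI[of _ e] exI[of _ 0] conjI) simp_all
        from product_exponents_add[OF this y]
        have "a \<in> product_exponents A (\<lambda>h. of_bool (h = g) + ?d h)" unfolding g(2) .
        also have "(\<lambda>h. of_bool (h = g) + ?d h) = d" using g(1) by (auto simp: fun_eq_iff)
        finally show ?thesis .
      qed
    qed
  qed
  have ideal: "is_ideal (product_ideal A d :: (('v \<Rightarrow>\<^sub>0 nat) \<Rightarrow>\<^sub>0 'k) set)"
    by (intro is_ideal_supported product_exponents_up)
  moreover have "integral_closure (product_ideal A d)
      \<subseteq> (product_ideal A d :: (('v \<Rightarrow>\<^sub>0 nat) \<Rightarrow>\<^sub>0 'k) set)"
    using product_ideal_integral_closure[of A d] sat unfolding supported_def by blast
  ultimately show ?thesis
    using subset_integral_closure unfolding complete_ideal_def by blast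
qed

section \<open>Three ideals in three variables\<close>

lemma UNIV_three: "UNIV = {0, 1, 2 :: 3}"
  by (rule card_subset_eq[symmetric]) simp_all

theorem theorem1p5:
  fixes I J K :: "'k::field poly3 set"
  assumes "monomial_ideal I" and "primary_to max_ideal_xyz I"
    and "monomial_ideal J" and "primary_to max_ideal_xyz J"
    and "monomial_ideal K" and "primary_to max_ideal_xyz K"
    and "\<forall>r s t :: nat. r + s + t \<le> 2 \<longrightarrow>
      complete_ideal (ideal_mult (ideal_mult (ideal_power I r) (ideal_power J s)) (ideal_power K t))"
  shows "\<forall>r s t :: nat.
      complete_ideal (ideal_mult (ideal_mult (ideal_power I r) (ideal_power J s)) (ideal_power K t))"
proof -
  obtain EI where EI: "I = ideal_gen (monomial ` EI)"
    using assms(1) unfolding monomial_ideal_def ..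
  obtain EJ where EJ: "J = ideal_gen (monomial ` EJ)"
    using assms(3) unfolding monomial_ideal_def ..
  obtain EK where EK: "K = ideal_gen (monomial ` EK)"
    using assms(5) unfolding monomial_ideal_def ..
  \<comment> \<open>The type \<open>3\<close> indexes the three ideals here and, separately, the
    variables; the bound \<open>CARD(3)\<close> below refers to the variables.\<close>
  define A :: "3 \<Rightarrow> (3 \<Rightarrow>\<^sub>0 nat) set" where "A g = (if g = 0 then EI else if g = 1 then EJ else EK)" for g
  have mon: "monomial = (\<lambda>e. Poly_Mapping.single e (1::'k))"
    by (simp add: monomial_def fun_eq_iff)
  have gen: "ideal_gen (monomial ` A g) = (product_ideal A (\<lambda>h. of_bool (h = g)) :: 'k poly3 set)" for g
    unfolding mon ideal_gen_monomials product_exponents_single ..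
  have IJK: "I = product_ideal A (\<lambda>h. of_bool (h = 0))" "J = product_ideal A (\<lambda>h. of_bool (h = 1))"
    "K = product_ideal A (\<lambda>h. of_bool (h = 2))"
    using EI EJ EK by (simp_all add: gen[symmetric] A_def)
  \<comment> \<open>Stated for every \<open>d\<close>, this identity translates the hypothesis and
    the conclusion alike into statements about \<open>product_ideal\<close>.\<close>
  have prod: "ideal_mult (ideal_mult (ideal_power I (d 0)) (ideal_power J (d 1))) (ideal_power K (d 2))
      = product_ideal A d" for d
  proof -
    have "(\<lambda>g. d 0 * of_bool (g = 0) + d 1 * of_bool (g = 1) + d 2 * of_bool (g = 2)) = d"
    proof
      fix g :: 3
      have "g \<in> {0, 1, 2}" using UNIV_three by blast
      then show "d 0 * of_bool (g = 0) + d 1 * of_bool (g = 1) + d 2 * of_bool (g = 2) = d g"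
        by auto
    qed
    then show ?thesis
      unfolding IJK product_ideal_power product_ideal_mult by simp
  qed
  have "complete_ideal (product_ideal A d :: 'k poly3 set)" if "sum d UNIV < CARD(3)" for d
  proof -
    have "sum d UNIV = d 0 + d 1 + d 2" unfolding UNIV_three by (simp add: add.assoc)
    then have "d 0 + d 1 + d 2 \<le> 2" using that by simp
    then show ?thesis
      using assms(7)[rule_format, of "d 0" "d 1" "d 2"] unfolding prod by simp
  qed
  then have complete: "complete_ideal (product_ideal A d :: 'k poly3 set)" for d
    by (rule complete_product_ideals)
  show ?thesis
  proof (intro allI)
    fix r s t :: nat
    define d :: "3 \<Rightarrow> nat" where "d g = (if g = 0 then r else if g = 1 then s else t)" for g
    show "complete_ideal (ideal_mult (ideal_mult (ideal_power I r) (ideal_power J s)) (ideal_power K t))"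
      using complete[of d, folded prod] by (simp add: d_def)
  qed
qed

end
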